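(* Let $f:\mathrm{Gr}(k,n)\to\mathbb{R}$ be (the restriction of) a $C^1$ function defined on an open neighbourhood of $\mathrm{Gr}(k,n)$ in $\mathbb{R}^{n\times n}$. For any $Q=[q_{ij}]\in\mathrm{Gr}(k,n)$, write \[ f_Q:=\Bigl[\frac{\partial f}{\partial q_{ij}}(Q)\Bigr]_{i,j=1}^n\in\mathbb{R}^{n\times n}. \] Then the Riemannian gradient of $f$ at $Q$ is \[ \nabla f(Q)=\tfrac14\bigl[f_Q+f_Q^{\mathsf T}-Q(f_Q+f_Q^{\mathsf T})Q\bigr]. \]
   Context: For $k\in\{1,\dots,n\}$, $\mathrm{Gr}(k,n)=\{Q\in\mathrm{O}(n):Q^{\mathsf T}=Q,\ \operatorname{tr}(Q)=2k-n\}$, an embedded submanifold of $\mathbb{R}^{n\times n}$, equipped with the Riemannian metric $\langle X,Y\rangle_Q=\operatorname{tr}(XY)$ for $X,Y\in\mathbb{T}_Q\mathrm{Gr}(k,n)$ (tangent vectors are symmetric matrices). The partial derivatives in $f_Q$ are with respect to the $n^2$ entries of a matrix in $\mathbb{R}^{n\times n}$. *)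

theory Defs
  imports "HOL-Analysis.Analysis"
begin

definition Gr :: "nat \<Rightarrow> (real^'n^'n) set" where
  "Gr k = {Q. orthogonal_matrix Q \<and> transpose Q = Q \<and> trace Q = 2 * real k - real CARD('n)}"

(* C1_differentiable_on is only available for functions of one real variable. *)
definition C1_on :: "'a::real_normed_vector set \<Rightarrow> ('a \<Rightarrow> 'b::real_normed_vector) \<Rightarrow> bool" where
  "C1_on U f \<longleftrightarrow>
     (\<exists>f'. (\<forall>x\<in>U. (f has_derivative blinfun_apply (f' x)) (at x)) \<and> continuous_on U f')"

definition curve_in_with_velocity ::
  "'a::real_normed_vector set \<Rightarrow> 'a \<Rightarrow> 'a \<Rightarrow> (real \<Rightarrow> 'a) \<Rightarrow> bool" where
  "curve_in_with_velocity M p v c \<longleftrightarrow>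
     (\<exists>e>0. c C1_differentiable_on {-e<..<e} \<and> c ` {-e<..<e} \<subseteq> M) \<and>
     c 0 = p \<and> (c has_vector_derivative v) (at 0)"

(* For a smoothly embedded submanifold M, velocities of C1 curves and of smooth curves
   give the same tangent space. *)
definition tangent_space :: "'a::real_normed_vector set \<Rightarrow> 'a \<Rightarrow> 'a set" where
  "tangent_space M p = {v. \<exists>c. curve_in_with_velocity M p v c}"

(* The differential of f restricted to M sends the velocity of a curve c in M to the derivative
   of f o c.  Hence the condition below says that G is tangent and represents this
   differential with respect to the metric g; it depends only on the values of f on M. *)
definition is_riemannian_gradient ::
  "'a::real_normed_vector set \<Rightarrow> ('a \<Rightarrow> 'a \<Rightarrow> 'a \<Rightarrow> real) \<Rightarrow> ('a \<Rightarrow> real) \<Rightarrow> 'a \<Rightarrow> 'a \<Rightarrow> bool" where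
  "is_riemannian_gradient M g f p G \<longleftrightarrow>
     G \<in> tangent_space M p \<and>
     (\<forall>v\<in>tangent_space M p. \<forall>c. curve_in_with_velocity M p v c \<longrightarrow>
        ((\<lambda>t. f (c t)) has_real_derivative g p G v) (at 0))"

definition riemannian_gradient ::
  "'a::real_normed_vector set \<Rightarrow> ('a \<Rightarrow> 'a \<Rightarrow> 'a \<Rightarrow> real) \<Rightarrow> ('a \<Rightarrow> real) \<Rightarrow> 'a \<Rightarrow> 'a" where
  "riemannian_gradient M g f p = (THE G. is_riemannian_gradient M g f p G)"

definition Gr_metric :: "real^'n^'n \<Rightarrow> real^'n^'n \<Rightarrow> real^'n^'n \<Rightarrow> real" where
  "Gr_metric Q X Y = trace (X ** Y)"

(* axis i (axis j 1) is the matrix unit with entry 1 in row i, column j. *)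
definition partials :: "(real^'n^'n \<Rightarrow> real) \<Rightarrow> real^'n^'n \<Rightarrow> real^'n^'n" where
  "partials f Q = (\<chi> i j. deriv (\<lambda>t. f (Q + t *\<^sub>R axis i (axis j 1))) 0)"

end

theory Submission
  imports Defs
begin

text \<open>
  The tangent space of the Grassmannian at \<open>Q\<close> consists of the symmetric matrices
  anticommuting with \<open>Q\<close>.  Differentiating the equations \<open>X\<^sup>T = X\<close> and
  \<open>X X = I\<close> along a curve gives one inclusion.  Conversely, if \<open>V\<close> is such a matrix, then
  \<open>S = V Q / 2\<close> is skew and anticommutes with \<open>Q\<close>, and the Cayley curve
  \<open>(I + t S) (I - t S)\<^sup>-\<^sup>1 Q\<close> stays in the Grassmannian and has velocity \<open>V\<close>
  at \<open>t = 0\<close>.  For tangent \<open>V\<close> we have \<open>Q V Q = - V\<close>, so the claimed gradient pairs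
  with \<open>V\<close> like the matrix of partial derivatives does.
\<close>

section \<open>Matrix algebra\<close>

lemma bounded_bilinear_matrix_matrix_mult:
  "bounded_bilinear ((**) :: real^'n^'m \<Rightarrow> real^'p^'n \<Rightarrow> real^'p^'m)"
  unfolding bilinear_conv_bounded_bilinear [symmetric] bilinear_def
  by (auto intro!: linearI
      simp: matrix_matrix_mult_def vec_eq_iff sum.distrib sum_distrib_left algebra_simps)

interpretation matrix_mult:
  bounded_bilinear "(**) :: real^'n^'m \<Rightarrow> real^'p^'n \<Rightarrow> real^'p^'m"
  by (rule bounded_bilinear_matrix_matrix_mult)

lemma bounded_linear_transpose: "bounded_linear (transpose :: real^'n^'m \<Rightarrow> real^'m^'n)"
  unfolding linear_conv_bounded_linear [symmetric]
  by (auto intro!: linearI simp: transpose_def vec_eq_iff)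

lemmas transpose_add = linear_add [OF bounded_linear.linear [OF bounded_linear_transpose]]
lemmas transpose_diff = linear_diff [OF bounded_linear.linear [OF bounded_linear_transpose]]

lemma trace_scaleR: "trace (r *\<^sub>R (A :: real^'n^'n)) = r * trace A"
  by (simp add: trace_def sum_distrib_left)

lemma trace_uminus: "trace (- A :: real^'n^'n) = - trace A"
  by (simp add: trace_def sum_negf)

text \<open>Ties the componentwise inner product to the trace form, so that \<open>Gr_metric\<close>
  may be treated as \<open>inner\<close> as soon as its first argument is symmetric.\<close>

lemma inner_eq_trace: "inner A B = trace (transpose A ** B)" for A B :: "real^'n^'m"
  unfolding trace_def matrix_matrix_mult_def transpose_def inner_vec_def
  by (simp, rule sum.swap)

lemma inner_transpose: "inner (transpose A) (transpose B) = inner A B" for A B :: "real^'n^'m"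
  unfolding inner_vec_def transpose_def
  by (simp, rule sum.swap)

lemma inner_matrix_mult_left: "inner (A ** B) C = inner B (transpose A ** C)"
  for A :: "real^'n^'m" and B :: "real^'p^'n" and C :: "real^'p^'m"
  by (simp add: inner_eq_trace matrix_transpose_mul matrix_mul_assoc)

lemma inner_matrix_mult_right: "inner (A ** B) C = inner A (C ** transpose B)"
  for A :: "real^'n^'m" and B :: "real^'p^'n" and C :: "real^'p^'m"
  by (simp add: inner_eq_trace matrix_transpose_mul)
     (metis matrix_mul_assoc trace_mul_sym)

section \<open>The resolvent of a skew matrix\<close>

text \<open>The Cayley transform of \<open>t *\<^sub>R S\<close> is twice this inverse minus the
  identity, so it is enough to study the inverse alone.\<close>

definition skew_resolvent :: "real^'n^'n \<Rightarrow> real \<Rightarrow> real^'n^'n" where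
  "skew_resolvent S t = matrix_inv (mat 1 - t *\<^sub>R S)"

text \<open>Skewness forces \<open>inner x (S *v x) = 0\<close>, and a kernel vector satisfies
  \<open>S *v x = x\<close>, so its norm is zero.\<close>

lemma invertible_one_minus_skew:
  fixes S :: "real^'n^'n"
  assumes "transpose S = - S"
  shows "invertible (mat 1 - S)"
proof -
  have "x = 0" if "(mat 1 - S) *v x = 0" for x
  proof -
    have "inner x (S *v x) = inner (transpose S *v x) x"
      by (simp add: dot_lmul_matrix)
    also have "transpose S *v x = - (S *v x)"
      using matrix_vector_mult_diff_rdistrib [of 0 S x] by (simp only: assms) simp
    also have "inner (- (S *v x)) x = - inner x (S *v x)"
      by (simp add: inner_commute)
    finally have "inner x (S *v x) = 0" by simp
    moreover have "S *v x = x"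
      using that by (simp add: matrix_vector_mult_diff_rdistrib)
    ultimately show "x = 0" by simp
  qed
  then have "\<exists>B. B ** (mat 1 - S) = mat 1"
    by (simp add: matrix_left_invertible_ker)
  then show ?thesis
    by (simp add: invertible_left_inverse)
qed

section \<open>Resolvent identities, norm bound and differentiability\<close>

context
  fixes S :: "real^'n^'n"
  assumes skew: "transpose S = - S"
begin

lemma
  shows skew_resolvent_left: "skew_resolvent S t ** (mat 1 - t *\<^sub>R S) = mat 1"
    and skew_resolvent_right: "(mat 1 - t *\<^sub>R S) ** skew_resolvent S t = mat 1"
proof -
  have "invertible (mat 1 - t *\<^sub>R S)"
    by (rule invertible_one_minus_skew) (simp add: transpose_scalar skew)
  then show "skew_resolvent S t ** (mat 1 - t *\<^sub>R S) = mat 1"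
    "(mat 1 - t *\<^sub>R S) ** skew_resolvent S t = mat 1"
    unfolding skew_resolvent_def matrix_inv_def invertible_def
    by (metis (mono_tags, lifting) someI_ex)+
qed

lemma skew_resolvent_0: "skew_resolvent S 0 = mat 1"
  using skew_resolvent_left [of 0] by simp

lemma transpose_skew_resolvent_left:
  "transpose (skew_resolvent S t) ** (mat 1 + t *\<^sub>R S) = mat 1"
  using arg_cong [OF skew_resolvent_right, of transpose t]
  by (simp add: matrix_transpose_mul transpose_diff transpose_scalar skew)

lemma transpose_skew_resolvent_right:
  "(mat 1 + t *\<^sub>R S) ** transpose (skew_resolvent S t) = mat 1"
  using transpose_skew_resolvent_left matrix_left_right_inverse by blast

text \<open>Insert into each summand the factor that the other one inverts; the two factors
  \<open>mat 1 + t *\<^sub>R S\<close> and \<open>mat 1 - t *\<^sub>R S\<close> add up to twice the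
  identity. The identity yields both the norm bound and the orthogonality of the Cayley
  transform.\<close>

lemma skew_resolvent_add_transpose:
  "skew_resolvent S t + transpose (skew_resolvent S t)
     = 2 *\<^sub>R (skew_resolvent S t ** transpose (skew_resolvent S t))"
    (is "?M + ?N = _")
proof -
  have "?M + ?N = ?M ** ((mat 1 + t *\<^sub>R S) ** ?N) + (?M ** (mat 1 - t *\<^sub>R S)) ** ?N"
    by (simp add: skew_resolvent_left transpose_skew_resolvent_right)
  also have "\<dots> = ?M ** ((mat 1 + t *\<^sub>R S) + (mat 1 - t *\<^sub>R S)) ** ?N"
    by (simp only: matrix_mult.add_left matrix_mult.add_right matrix_mul_assoc)
  also have "(mat 1 + t *\<^sub>R S) + (mat 1 - t *\<^sub>R S) = 2 *\<^sub>R mat 1"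
    by (simp only: scaleR_2) simp
  also have "?M ** (2 *\<^sub>R mat 1) ** ?N = 2 *\<^sub>R (?M ** ?N)"
    by (simp only: matrix_mult.scaleR_right matrix_mult.scaleR_left matrix_mul_rid)
  finally show ?thesis .
qed

text \<open>Traces in the preceding identity show that the squared norm of the resolvent is its
  inner product with the identity matrix; Cauchy-Schwarz then gives a bound uniform in
  \<open>t\<close>.\<close>

lemma norm_skew_resolvent_le: "norm (skew_resolvent S t) \<le> norm (mat 1 :: real^'n^'n)"
proof -
  let ?M = "skew_resolvent S t"
  have "trace (?M + transpose ?M) = 2 * trace (?M ** transpose ?M)"
    by (simp add: skew_resolvent_add_transpose trace_scaleR)
  moreover have "trace (transpose ?M) = trace ?M"
    by (simp add: trace_def transpose_def)
  ultimately have "inner ?M ?M = inner (mat 1) ?M"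
    by (simp add: inner_eq_trace trace_add trace_mul_sym [of ?M])
  also have "\<dots> \<le> norm (mat 1 :: real^'n^'n) * norm ?M"
    by (rule norm_cauchy_schwarz)
  finally show ?thesis
    by (cases "norm ?M = 0") (simp_all add: power2_norm_eq_inner [symmetric] power2_eq_square)
qed

text \<open>This is the resolvent identity: multiply each term by the missing factor and its
  inverse, then subtract the two middle factors.\<close>

lemma skew_resolvent_diff:
  "skew_resolvent S t - skew_resolvent S s
     = (t - s) *\<^sub>R (skew_resolvent S t ** S ** skew_resolvent S s)"
    (is "?M - ?N = _")
proof -
  have "?M - ?N = ?M ** ((mat 1 - s *\<^sub>R S) ** ?N) - (?M ** (mat 1 - t *\<^sub>R S)) ** ?N"
    by (simp add: skew_resolvent_left skew_resolvent_right)
  also have "\<dots> = ?M ** ((mat 1 - s *\<^sub>R S) - (mat 1 - t *\<^sub>R S)) ** ?N"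
    by (simp only: matrix_mult.diff_left matrix_mult.diff_right matrix_mul_assoc)
  also have "(mat 1 - s *\<^sub>R S) - (mat 1 - t *\<^sub>R S) = (t - s) *\<^sub>R S"
    by (simp add: algebra_simps)
  finally show ?thesis
    by (simp add: matrix_mult.scaleR_right matrix_mult.scaleR_left)
qed

lemma isCont_skew_resolvent: "isCont (skew_resolvent S) s"
proof -
  obtain K where K: "K \<ge> 0"
      "\<And>(A :: real^'n^'n) (B :: real^'n^'n). norm (A ** B) \<le> norm A * norm B * K"
    using matrix_mult.nonneg_bounded by metis
  \<comment> \<open>By the uniform norm bound \<open>C\<close> depends on \<open>s\<close> but not
    on \<open>t\<close>, which gives a Lipschitz estimate at \<open>s\<close>.\<close>
  define C where "C = norm (mat 1 :: real^'n^'n) * norm (S ** skew_resolvent S s) * K"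
  have "norm (skew_resolvent S t - skew_resolvent S s) \<le> \<bar>t - s\<bar> * C" for t
  proof -
    have "norm (skew_resolvent S t ** (S ** skew_resolvent S s))
        \<le> norm (skew_resolvent S t) * norm (S ** skew_resolvent S s) * K"
      by (rule K)
    also have "\<dots> \<le> C"
      unfolding C_def by (intro mult_right_mono norm_skew_resolvent_le) (simp_all add: K)
    finally show ?thesis
      by (simp add: skew_resolvent_diff matrix_mul_assoc mult_left_mono)
  qed
  then have "\<forall>\<^sub>F t in at s. norm (skew_resolvent S t - skew_resolvent S s) \<le> \<bar>t - s\<bar> * C"
    by (rule always_eventually [OF allI])
  moreover have "((\<lambda>t. \<bar>t - s\<bar> * C) \<longlongrightarrow> \<bar>s - s\<bar> * C) (at s)"
    by (intro tendsto_intros)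
  then have "((\<lambda>t. \<bar>t - s\<bar> * C) \<longlongrightarrow> 0) (at s)"
    by simp
  ultimately have "((\<lambda>t. skew_resolvent S t - skew_resolvent S s) \<longlongrightarrow> 0) (at s)"
    by (rule Lim_null_comparison)
  then show ?thesis
    by (simp only: isCont_def LIM_zero_iff)
qed

text \<open>By the resolvent identity the difference quotient at \<open>t\<close> is exactly
  \<open>?q t\<close>, so continuity of the resolvent at \<open>s\<close> yields the
  derivative.\<close>

lemma has_vector_derivative_skew_resolvent:
  "(skew_resolvent S has_vector_derivative skew_resolvent S s ** S ** skew_resolvent S s) (at s)"
    (is "(_ has_vector_derivative ?D) _")
proof -
  let ?q = "\<lambda>t. skew_resolvent S t ** S ** skew_resolvent S s"
  have "(?q \<longlongrightarrow> ?D) (at s)"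
    using isCont_skew_resolvent [of s] unfolding isCont_def
    by (intro matrix_mult.tendsto tendsto_const)
  then have "((\<lambda>t. norm (?q t - ?D)) \<longlongrightarrow> 0) (at s)"
    by (simp add: LIM_zero tendsto_norm_zero)
  moreover have "norm (?q t - ?D)
      = norm (skew_resolvent S t - skew_resolvent S s - (t - s) *\<^sub>R ?D) / norm (t - s)"
    if "t \<noteq> s" for t
    using that by (simp add: skew_resolvent_diff flip: scaleR_diff_right)
  ultimately have "((\<lambda>t. norm (skew_resolvent S t - skew_resolvent S s - (t - s) *\<^sub>R ?D)
      / norm (t - s)) \<longlongrightarrow> 0) (at s)"
    by (rule Lim_transform_eventually [OF _ eventually_mono [OF eventually_neq_at_within]])
  then show ?thesis
    by (simp add: has_vector_derivative_def has_derivative_iff_norm bounded_linear_scaleR_left)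
qed

end

section \<open>The tangent space of the Grassmannian\<close>

text \<open>For symmetric \<open>Q\<close> orthogonality becomes \<open>Q ** Q = mat 1\<close>, the
  form that is differentiated along curves below.\<close>

lemma Gr_iff:
  "Q \<in> Gr k \<longleftrightarrow>
     transpose Q = Q \<and> Q ** Q = mat 1 \<and> trace Q = 2 * real k - real CARD('n)"
  for Q :: "real^'n^'n"
  unfolding Gr_def orthogonal_matrix mem_Collect_eq by metis

lemma tangent_space_GrD:
  fixes Q V :: "real^'n^'n"
  assumes "V \<in> tangent_space (Gr k) Q"
  shows "transpose V = V" and "Q ** V = - (V ** Q)"
proof -
  obtain c e where "e > 0" and c: "c ` {-e<..<e} \<subseteq> Gr k" "c 0 = Q"
    and der: "(c has_vector_derivative V) (at 0)"
    using assms unfolding tangent_space_def curve_in_with_velocity_def by auto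
  have inGr: "transpose (c t) = c t" "c t ** c t = mat 1" if "t \<in> {-e<..<e}" for t
    using c that by (auto simp: Gr_iff image_subset_iff)
  have "((\<lambda>t. transpose (c t)) has_vector_derivative transpose V) (at 0)"
    by (rule bounded_linear.has_vector_derivative [OF bounded_linear_transpose der])
  \<comment> \<open>The curve agrees with its transpose near 0, so both derivatives belong to the
    same curve and must coincide.\<close>
  then have "(c has_vector_derivative transpose V) (at 0)"
    by (rule has_vector_derivative_transform_within_open [where S = "{-e<..<e}"])
       (use \<open>e > 0\<close> inGr in auto)
  with der show "transpose V = V"
    by (metis vector_derivative_unique_at)
  have "((\<lambda>t. c t ** c t) has_vector_derivative c 0 ** V + V ** c 0) (at 0)"
    by (rule matrix_mult.has_vector_derivative [OF der der])
  then have "((\<lambda>t. mat 1) has_vector_derivative c 0 ** V + V ** c 0) (at 0)"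
    by (rule has_vector_derivative_transform_within_open [where S = "{-e<..<e}"])
       (use \<open>e > 0\<close> inGr in auto)
  then have "c 0 ** V + V ** c 0 = 0"
    using vector_derivative_unique_at has_vector_derivative_const by blast
  then show "Q ** V = - (V ** Q)"
    using c(2) by (simp add: eq_neg_iff_add_eq_0)
qed

section \<open>Cayley curves in the Grassmannian\<close>

context
  fixes S Q :: "real^'n^'n"
  assumes skew: "transpose S = - S" and anti: "Q ** S = - (S ** Q)"
begin

text \<open>Moving \<open>Q\<close> past \<open>S\<close> flips the sign of \<open>t\<close>; since
  the transposed resolvent inverts \<open>mat 1 + t *\<^sub>R S\<close>, cancelling the factors on
  both sides transfers this to the inverses.\<close>

lemma mult_transpose_skew_resolvent:
  "Q ** transpose (skew_resolvent S t) = skew_resolvent S t ** Q" (is "Q ** ?N = ?M ** Q")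
proof -
  have "Q ** (mat 1 + t *\<^sub>R S) = (mat 1 - t *\<^sub>R S) ** Q"
    by (simp add: matrix_mult.add_right matrix_mult.diff_left matrix_mult.scaleR_right
        matrix_mult.scaleR_left anti)
  then have "?M ** (Q ** (mat 1 + t *\<^sub>R S)) ** ?N = ?M ** ((mat 1 - t *\<^sub>R S) ** Q) ** ?N"
    by simp
  moreover have "?M ** (Q ** (mat 1 + t *\<^sub>R S)) ** ?N
      = ?M ** Q ** ((mat 1 + t *\<^sub>R S) ** ?N)"
    by (simp add: matrix_mul_assoc)
  moreover have "?M ** ((mat 1 - t *\<^sub>R S) ** Q) ** ?N = (?M ** (mat 1 - t *\<^sub>R S)) ** Q ** ?N"
    by (simp only: matrix_mul_assoc)
  ultimately show ?thesis
    by (simp add: skew_resolvent_left [OF skew] transpose_skew_resolvent_right [OF skew])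
qed

text \<open>
  The difference is \<open>t tr (M S Q)\<close> for the resolvent \<open>M\<close>, and this trace equals its own
  negative, because \<open>M\<close> commutes with \<open>S\<close> and \<open>Q\<close> anticommutes with \<open>S\<close>.
\<close>
lemma trace_skew_resolvent_mult: "trace (skew_resolvent S t ** Q) = trace Q"
proof -
  let ?M = "skew_resolvent S t"
  have left: "?M - mat 1 = t *\<^sub>R (?M ** S)"
    using skew_resolvent_left [OF skew, of t]
    by (simp add: matrix_mult.diff_right matrix_mult.scaleR_right algebra_simps)
  have right: "?M - mat 1 = t *\<^sub>R (S ** ?M)"
    using skew_resolvent_right [OF skew, of t]
    by (simp add: matrix_mult.diff_left matrix_mult.scaleR_left algebra_simps)
  have "t * trace (?M ** S ** Q) = - (t * trace (?M ** (Q ** S)))"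
    by (simp add: anti matrix_mult.minus_right trace_uminus matrix_mul_assoc)
  also have "trace (?M ** (Q ** S)) = trace (S ** ?M ** Q)"
    by (metis matrix_mul_assoc trace_mul_sym)
  also have "t * trace (S ** ?M ** Q) = t * trace (?M ** S ** Q)"
    using left right by (simp flip: trace_scaleR matrix_mult.scaleR_left)
  finally have "t * trace (?M ** S ** Q) = 0" by simp
  then have "trace ((?M - mat 1) ** Q) = 0"
    by (simp add: left matrix_mult.scaleR_left trace_scaleR)
  then show ?thesis
    by (simp add: matrix_mult.diff_left trace_sub)
qed

text \<open>\<open>2 M - I\<close> is the Cayley transform \<open>(I + t S) (I - t S)\<^sup>-\<^sup>1\<close>.\<close>
lemma cayley_curve_in_Gr:
  assumes Q: "Q \<in> Gr k"
  shows "2 *\<^sub>R (skew_resolvent S t ** Q) - Q \<in> Gr k"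
proof -
  let ?M = "skew_resolvent S t"
  let ?N = "transpose (skew_resolvent S t)"
  let ?R = "2 *\<^sub>R ?M - mat 1"
  let ?c = "2 *\<^sub>R (?M ** Q) - Q"
  have tQ: "transpose Q = Q" and QQ: "Q ** Q = mat 1" using Q by (auto simp: Gr_iff)
  have sym: "transpose ?c = ?c"
    by (simp add: transpose_diff transpose_scalar matrix_transpose_mul tQ
        mult_transpose_skew_resolvent)
  have cR: "?c = ?R ** Q"
    by (simp add: matrix_mult.diff_left matrix_mult.scaleR_left)
  \<comment> \<open>With one factor written as \<open>?R ** Q\<close> and the other as
    \<open>Q ** transpose ?R\<close>, the square of \<open>?c\<close> collapses to
    \<open>?R ** transpose ?R\<close>.\<close>
  then have "?c = Q ** transpose ?R"
    using sym by (metis matrix_transpose_mul tQ)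
  then have "?c ** ?c = ?R ** (Q ** Q) ** transpose ?R"
    using cR by (metis matrix_mul_assoc)
  also have "\<dots> = ?R ** (2 *\<^sub>R ?N - mat 1)"
    by (simp add: QQ transpose_diff transpose_scalar)
  also have "\<dots> = 2 *\<^sub>R (2 *\<^sub>R (?M ** ?N)) - 2 *\<^sub>R (?M + ?N) + mat 1"
    by (simp add: matrix_mult.diff_left matrix_mult.diff_right matrix_mult.scaleR_left
        matrix_mult.scaleR_right algebra_simps)
  also have "\<dots> = mat 1"
    by (simp add: skew_resolvent_add_transpose [OF skew])
  finally have "?c ** ?c = mat 1" .
  moreover have "trace ?c = trace Q"
    by (simp add: trace_sub trace_scaleR trace_skew_resolvent_mult)
  ultimately show ?thesis
    using sym Q by (simp add: Gr_iff)
qed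

end

lemma tangent_space_GrI:
  fixes Q V :: "real^'n^'n"
  assumes Q: "Q \<in> Gr k" and sym: "transpose V = V" and anti: "Q ** V = - (V ** Q)"
  shows "V \<in> tangent_space (Gr k) Q"
proof -
  \<comment> \<open>The factor 1/2 offsets the 2 in \<open>c\<close>: the velocity at 0 is
    \<open>2 *\<^sub>R (S ** Q)\<close>, which is \<open>V ** Q ** Q\<close>, hence
    \<open>V\<close>.\<close>
  define S where "S = (1/2) *\<^sub>R (V ** Q)"
  define c where "c = (\<lambda>t. 2 *\<^sub>R (skew_resolvent S t ** Q) - Q)"
  define D where
    "D = (\<lambda>t. 2 *\<^sub>R (skew_resolvent S t ** S ** skew_resolvent S t ** Q))"
  have tQ: "transpose Q = Q" and QQ: "Q ** Q = mat 1" using Q by (auto simp: Gr_iff)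
  have skew: "transpose S = - S"
    by (simp add: S_def transpose_scalar matrix_transpose_mul tQ sym anti)
  have antiS: "Q ** S = - (S ** Q)"
    by (simp add: S_def matrix_mult.scaleR_left matrix_mult.scaleR_right anti matrix_mul_assoc
        matrix_mult.minus_left)
  have der: "(c has_vector_derivative D t) (at t)" for t
  proof -
    have "((\<lambda>t. skew_resolvent S t ** Q) has_vector_derivative
        skew_resolvent S t ** S ** skew_resolvent S t ** Q) (at t)"
      by (rule bounded_linear.has_vector_derivative [OF matrix_mult.bounded_linear_left
            has_vector_derivative_skew_resolvent [OF skew]])
    then have "(c has_vector_derivative
        2 *\<^sub>R (skew_resolvent S t ** S ** skew_resolvent S t ** Q) - 0) (at t)"
      unfolding c_def
      by (intro has_vector_derivative_diff has_vector_derivative_const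
          bounded_linear.has_vector_derivative [OF bounded_linear_scaleR_right])
    then show ?thesis by (simp add: D_def)
  qed
  have "continuous_on UNIV D"
    unfolding D_def
    by (intro continuous_intros matrix_mult.continuous_on)
       (auto intro!: continuous_at_imp_continuous_on isCont_skew_resolvent skew)
  \<comment> \<open>The curve is defined on the whole line, so the radius 1 is an arbitrary
    choice.\<close>
  then have "c C1_differentiable_on {-1<..<1}"
    unfolding C1_differentiable_on_def using der continuous_on_subset by blast
  moreover have "c t \<in> Gr k" for t
    unfolding c_def by (rule cayley_curve_in_Gr [OF skew antiS Q])
  moreover have "c 0 = Q"
    by (simp add: c_def skew_resolvent_0 [OF skew] scaleR_2)
  moreover have "D 0 = V"
    unfolding D_def skew_resolvent_0 [OF skew]
    by (simp add: S_def matrix_mult.scaleR_left QQ flip: matrix_mul_assoc)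
  ultimately have "curve_in_with_velocity (Gr k) Q V c"
    unfolding curve_in_with_velocity_def using der [of 0]
    by (intro conjI exI [of _ "1::real"]) auto
  then show ?thesis
    unfolding tangent_space_def by blast
qed

section \<open>The Riemannian gradient\<close>

text \<open>Both candidates are themselves tangent, so pairing \<open>G - H\<close> with
  \<open>G\<close> and with \<open>H\<close> gives 0, and hence \<open>G - H\<close> has norm
  zero.\<close>

lemma is_riemannian_gradient_unique:
  assumes G: "is_riemannian_gradient (Gr k) Gr_metric f Q G"
    and H: "is_riemannian_gradient (Gr k) Gr_metric f Q H"
  shows "G = H"
proof -
  have pair: "Gr_metric Q G v = Gr_metric Q H v" if v: "v \<in> tangent_space (Gr k) Q" for v
  proof -
    obtain c where "curve_in_with_velocity (Gr k) Q v c"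
      using v by (auto simp: tangent_space_def)
    with v G H show ?thesis
      unfolding is_riemannian_gradient_def using DERIV_unique by blast
  qed
  have tan: "G \<in> tangent_space (Gr k) Q" "H \<in> tangent_space (Gr k) Q"
    using G H by (auto simp: is_riemannian_gradient_def)
  have "inner G v = inner H v" if "v \<in> tangent_space (Gr k) Q" for v
    using pair [OF that] tan by (simp add: Gr_metric_def inner_eq_trace tangent_space_GrD(1))
  then have "inner (G - H) G = 0" "inner (G - H) H = 0"
    using tan by (simp_all add: inner_diff_left)
  then have "inner (G - H) (G - H) = 0"
    by (simp add: inner_diff_right)
  then show ?thesis by simp
qed

text \<open>Expand \<open>V\<close> in matrix units; on each unit the differential is the
  corresponding partial derivative, by the chain rule along a line through \<open>Q\<close>.\<close>

lemma has_derivative_eq_inner_partials: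
  fixes f :: "real^'n^'n \<Rightarrow> real"
  assumes f: "(f has_derivative f') (at Q)"
  shows "f' V = inner (partials f Q) V"
proof -
  have lin: "linear f'"
    using f has_derivative_linear by blast
  have part: "partials f Q $ i $ j = f' (axis i (axis j 1))" for i j
  proof -
    let ?E = "axis i (axis j 1) :: real^'n^'n"
    have "((\<lambda>t. Q + t *\<^sub>R ?E) has_derivative (\<lambda>t. t *\<^sub>R ?E)) (at 0)"
      by (auto intro!: derivative_eq_intros)
    then have "((\<lambda>t. f (Q + t *\<^sub>R ?E)) has_derivative (\<lambda>t. f' (t *\<^sub>R ?E))) (at 0)"
      by (rule has_derivative_compose) (simp add: f)
    then have "((\<lambda>t. f (Q + t *\<^sub>R ?E)) has_real_derivative f' ?E) (at 0)"
      by (simp add: has_field_derivative_def linear_cmul [OF lin] mult_commute_abs)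
    then show ?thesis
      by (simp add: partials_def DERIV_imp_deriv)
  qed
  \<comment> \<open>Lets the simplifier pull a test on the row index out of the inner sum over
    columns.\<close>
  have if_sum: "(\<Sum>b\<in>UNIV. if P then g b else 0) = (if P then sum g UNIV else 0)"
    for P and g :: "'n \<Rightarrow> real"
    by simp
  have "V = (\<Sum>i\<in>UNIV. \<Sum>j\<in>UNIV. V $ i $ j *\<^sub>R axis i (axis j 1))"
    by (simp add: vec_eq_iff axis_def if_distrib [of "\<lambda>x. x $ _"] if_distrib [of "\<lambda>x. _ * x"]
        if_sum cong: if_cong)
  then have "f' V = f' (\<Sum>i\<in>UNIV. \<Sum>j\<in>UNIV. V $ i $ j *\<^sub>R axis i (axis j 1))"
    by (rule arg_cong)
  also have "\<dots> = (\<Sum>i\<in>UNIV. \<Sum>j\<in>UNIV. V $ i $ j * partials f Q $ i $ j)"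
    by (simp add: linear_sum [OF lin] linear_cmul [OF lin] part)
  finally show ?thesis
    by (simp add: inner_vec_def mult.commute)
qed

text \<open>The matrix is the orthogonal projection of \<open>partials f Q\<close> onto the tangent
  space: one factor 1/2 comes from symmetrizing, the other from averaging \<open>X\<close> and
  \<open>- (Q ** X ** Q)\<close> to obtain a matrix anticommuting with \<open>Q\<close>.\<close>

lemma is_riemannian_gradient_Gr:
  fixes f :: "real^'n^'n \<Rightarrow> real"
  assumes f: "f differentiable (at Q)" and Q: "Q \<in> Gr k"
  shows "is_riemannian_gradient (Gr k) Gr_metric f Q
    ((1/4) *\<^sub>R (partials f Q + transpose (partials f Q)
       - Q ** (partials f Q + transpose (partials f Q)) ** Q))"
proof -
  define F where "F = partials f Q"
  define H where "H = F + transpose F"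
  define G where "G = (1/4) *\<^sub>R (H - Q ** H ** Q)"
  have tQ: "transpose Q = Q" and QQ: "Q ** Q = mat 1" using Q by (auto simp: Gr_iff)
  have tH: "transpose H = H"
    by (simp add: H_def transpose_add add.commute)
  have tG: "transpose G = G"
    by (simp add: G_def transpose_scalar transpose_diff matrix_transpose_mul tH tQ matrix_mul_assoc)
  have "Q ** (Q ** H ** Q) = H ** Q"
    by (simp add: matrix_mul_assoc QQ)
  moreover have "Q ** H ** Q ** Q = Q ** H"
    by (simp add: QQ flip: matrix_mul_assoc)
  ultimately have "Q ** G = - (G ** Q)"
    by (simp add: G_def matrix_mult.scaleR_left matrix_mult.scaleR_right
        matrix_mult.diff_left matrix_mult.diff_right flip: scaleR_minus_right)
  then have tan: "G \<in> tangent_space (Gr k) Q"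
    using tangent_space_GrI Q tG by blast
  have met: "Gr_metric Q G V = inner F V" if V: "V \<in> tangent_space (Gr k) Q" for V
  proof -
    note tV = tangent_space_GrD [OF V]
    have "inner (Q ** H ** Q) V = inner (Q ** H) (V ** Q)"
      by (simp add: inner_matrix_mult_right [of _ Q] tQ)
    also have "\<dots> = inner H (Q ** V ** Q)"
      by (simp add: inner_matrix_mult_left tQ matrix_mul_assoc)
    also have "Q ** V ** Q = - V"
      by (simp add: tV(2) matrix_mult.minus_left QQ flip: matrix_mul_assoc)
    finally have "inner G V = (1/2) * inner H V"
      by (simp add: G_def inner_diff_left)
    \<comment> \<open>A symmetric \<open>V\<close> pairs equally with \<open>F\<close> and with its
      transpose.\<close>
    also have "inner H V = 2 * inner F V"
      using inner_transpose [of F V] by (simp add: H_def inner_add_left tV(1))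
    finally show ?thesis
      by (simp add: Gr_metric_def inner_eq_trace [of G] tG)
  qed
  have "((\<lambda>t. f (c t)) has_real_derivative Gr_metric Q G V) (at 0)"
    if V: "V \<in> tangent_space (Gr k) Q" and c: "curve_in_with_velocity (Gr k) Q V c" for V c
  proof -
    obtain f' where f': "(f has_derivative f') (at Q)"
      using f unfolding differentiable_def by blast
    have "c 0 = Q" and "(c has_derivative (\<lambda>t. t *\<^sub>R V)) (at 0)"
      using c by (auto simp: curve_in_with_velocity_def has_vector_derivative_def)
    then have "((\<lambda>t. f (c t)) has_derivative (\<lambda>t. f' (t *\<^sub>R V))) (at 0)"
      using has_derivative_compose f' by blast
    then show ?thesis
      by (simp add: has_field_derivative_def met [OF V] F_def
          has_derivative_eq_inner_partials [OF f'] mult_commute_abs)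
  qed
  with tan show ?thesis
    unfolding is_riemannian_gradient_def G_def H_def F_def by blast
qed

theorem proposition5p1:
  fixes f :: "real^'n^'n \<Rightarrow> real" and U :: "(real^'n^'n) set" and Q :: "real^'n^'n" and k :: nat
  assumes "1 \<le> k" and "k \<le> CARD('n)"
    and "open U" and "Gr k \<subseteq> U" and "C1_on U f"
    and "Q \<in> Gr k"
  shows "(\<exists>!G. is_riemannian_gradient (Gr k) Gr_metric f Q G) \<and>
    riemannian_gradient (Gr k) Gr_metric f Q =
      (1/4) *\<^sub>R (partials f Q + transpose (partials f Q)
               - Q ** (partials f Q + transpose (partials f Q)) ** Q)"
proof -
  have "f differentiable (at Q)"
    using assms unfolding C1_on_def differentiable_def by blast
  note grad = is_riemannian_gradient_Gr [OF this \<open>Q \<in> Gr k\<close>]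
  show ?thesis
    \<comment> \<open>Existence and uniqueness together make the definite description denote the
      exhibited matrix.\<close>
    unfolding riemannian_gradient_def
    using grad is_riemannian_gradient_unique by (blast intro!: the_equality)
qed

end
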